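(* Let $M$ and $N$ be bounded residuated multilattices, and let $M\oplus N$ denote their ordinal sum (as pocrims). Then: (1) $M\oplus N$ is a residuated multilattice. (2) $M$ is a full residuated sub-multilattice of $M\oplus N$ if and only if $M$ has a unique coatom. (3) $N$ is a filter of $M\oplus N$, and in particular a full residuated sub-multilattice of $M\oplus N$. (4) The quotient residuated multilattice $(M\oplus N)/N$ is canonically isomorphic to $M$. (5) $N$ is a consistent filter of $M\oplus N$ if and only if $M$ is a residuated lattice.
   Context: For a poset $(P,\le)$ and $X\subseteq P$, $\sqcup X$ (resp. $\sqcap X$) is the set of minimal upper (resp. maximal lower) bounds of $X$; $x\sqcup y:=\sqcup\{x,y\}$, $x\sqcap y:=\sqcap\{x,y\}$. $P$ is a multilattice if for every finite $X\subseteq P$ each upper bound of $X$ is above an element of $\sqcup X$ and each lower bound of $X$ is below an element of $\sqcap X$. A pocrim is a structure $(A,\le,\top,\odot,\to)$ where $\top$ is the greatest element of the poset $(A,\le)$, $(A,\odot,\top)$ is a commutative monoid, and $a\odot c\le b\iff c\le a\to b$ for all $a,b,c\in A$. It is bounded if it has a least element $\bot$. A residuated multilattice (resp. residuated lattice) is a pocrim whose underlying poset is a multilattice (resp. lattice). For $x,y\in A$ and $X\subseteq A$, operations are applied to sets elementwise, e.g. $X\to y=\{x\to y: x\in X\}$, $x\to X=\{x\to t:t\in X\}$. A coatom is a maximal element of $A\setminus\{\top\}$. Ordinal sum: for pocrims $A,B$, the underlying set of $A\oplus B$ is the disjoint union of $A$ and $B$ with $\top_A$ and $\top_B$ identified (so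 $A$ and $B$ are regarded as subsets). The order: $x\le y$ iff ($x,y\in A$ and $x\le_A y$) or ($x,y\in B$ and $x\le_B y$) or ($x\in A\setminus\{\top_A\}$ and $y\in B$). The operations: $x\odot y=x\odot_A y$ if $x,y\in A$; $x\odot_B y$ if $x,y\in B$; $x$ if $x\in A\setminus\{\top_A\}$, $y\in B$; $y$ if $x\in B$, $y\in A\setminus\{\top_A\}$. And $x\to y=x\to_A y$ if $x,y\in A$; $x\to_B y$ if $x,y\in B$; $\top_B$ if $x\in A\setminus\{\top_A\}$, $y\in B$; $y$ if $x\in B$, $y\in A\setminus\{\top_A\}$. This is a pocrim. A subset $X$ of a residuated multilattice $A$ is a full residuated sub-multilattice if $\top\in X$, and for all $x,y\in X$: $x\odot y\in X$, $x\to y\in X$, $x\sqcup y\subseteq X$ and $x\sqcap y\subseteq X$ (computed in $A$). A deductive system of a pocrim $A$ is a nonempty $F\subseteq A$ with $\top\in F$ such that $x,\,x\to y\in F$ implies $y\in F$. A filter of a residuated multilattice is a deductive system $F$ such that $x\to y\in F$ implies $(x\sqcup y)\to y\subseteq F$ and $x\to(x\sqcap y)\subseteq F$. A deductive system $F$ is consistent if for all $x,y,z$: $x\to z,y\to z\in F$ implies $(x\sqcup y)\to z\subseteq F$, and $z\to x,z\to y\in F$ implies $z\to(x\sqcap y)\subseteq F$. (Consistent deductive systems are filters.) For a filter $F$ of a residuated multilattice $A$, the relation $x\,\mathcal{R}_F\,y\iff x\to y\in F$ and $y\to x\in F$ is a congruence, and the quotient $A/F$ is a residuated multilattice with top $[\top]$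 and $[x]\sqcup[y]=\{[t]:t\in x\sqcup y\}$, $[x]\sqcap[y]=\{[t]:t\in x\sqcap y\}$, $[x]\odot[y]=[x\odot y]$, $[x]\to[y]=[x\to y]$ (so $[x]\le[y]$ iff $x\to y\in F$). A homomorphism of residuated multilattices is a map $h$ with $h(x\sqcup y)\subseteq h(x)\sqcup h(y)$, $h(x\sqcap y)\subseteq h(x)\sqcap h(y)$, $h(x\odot y)=h(x)\odot h(y)$, $h(x\to y)=h(x)\to h(y)$; an isomorphism is a bijective homomorphism. In (4), "canonically" refers to the map $(M\oplus N)/N\to M$ sending $[x]$ to $x$ for $x\in M\setminus\{\top_M\}$ and to $\top_M$ otherwise.
   Formalization: Part (2) is false as stated (e.g. M = N = the Gödel chain [0,1]: M is full but has no coatom); it is proved only for M and N both nontrivial and M coatomic, i.e. every element of M other than the top lies below a coatom (automatic for finite M). *)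

theory Defs
  imports "HOL-Algebra.Group" "HOL-Algebra.Lattice"
begin

section \<open>Multilattices\<close>

definition min_upper :: "('a, 'm) gorder_scheme \<Rightarrow> 'a set \<Rightarrow> 'a set" where
  "min_upper P X = {u \<in> Upper P X. \<forall>v \<in> Upper P X. v \<sqsubseteq>\<^bsub>P\<^esub> u \<longrightarrow> v = u}"

definition max_lower :: "('a, 'm) gorder_scheme \<Rightarrow> 'a set \<Rightarrow> 'a set" where
  "max_lower P X = {l \<in> Lower P X. \<forall>v \<in> Lower P X. l \<sqsubseteq>\<^bsub>P\<^esub> v \<longrightarrow> v = l}"

text \<open>The finite set in the following axioms may be empty.\<close>

locale multilattice = partial_order P for P (structure) +
  assumes min_upper_below:
      "\<lbrakk>finite X; X \<subseteq> carrier P; u \<in> Upper P X\<rbrakk> \<Longrightarrow> \<exists>m \<in> min_upper P X. m \<sqsubseteq> u"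
    and max_lower_above:
      "\<lbrakk>finite X; X \<subseteq> carrier P; l \<in> Lower P X\<rbrakk> \<Longrightarrow> \<exists>m \<in> max_lower P X. l \<sqsubseteq> m"


section \<open>Pocrims and residuated multilattices\<close>

text \<open>The unit \<^term>\<open>\<one>\<^bsub>A\<^esub>\<close> of the underlying monoid is the top element.\<close>

record 'a pocrim = "'a monoid" +
  leq :: "'a \<Rightarrow> 'a \<Rightarrow> bool" (infixl \<open>\<preceq>\<index>\<close> 50)
  imp :: "'a \<Rightarrow> 'a \<Rightarrow> 'a" (infixr \<open>\<leadsto>\<index>\<close> 60)

definition poset_of :: "('a, 'm) pocrim_scheme \<Rightarrow> 'a gorder" where
  "poset_of A = \<lparr>carrier = carrier A, eq = (=), le = leq A\<rparr>"

locale pocrim = comm_monoid A + order: partial_order "poset_of A" for A (structure) +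
  assumes top_greatest: "a \<in> carrier A \<Longrightarrow> a \<preceq> \<one>"
    and imp_closed: "\<lbrakk>a \<in> carrier A; b \<in> carrier A\<rbrakk> \<Longrightarrow> a \<leadsto> b \<in> carrier A"
    and residuation:
      "\<lbrakk>a \<in> carrier A; b \<in> carrier A; c \<in> carrier A\<rbrakk> \<Longrightarrow> a \<otimes> c \<preceq> b \<longleftrightarrow> c \<preceq> a \<leadsto> b"

locale residuated_multilattice = pocrim A + multilattice "poset_of A" for A (structure)

locale residuated_lattice = pocrim A + lattice "poset_of A" for A (structure)

definition has_bottom :: "('a, 'm) pocrim_scheme \<Rightarrow> bool" where
  "has_bottom A \<longleftrightarrow> (\<exists>b. least (poset_of A) b (carrier A))"

definition coatom :: "('a, 'm) pocrim_scheme \<Rightarrow> 'a \<Rightarrow> bool" where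
  "coatom A c \<longleftrightarrow> c \<in> carrier A - {\<one>\<^bsub>A\<^esub>} \<and>
     (\<forall>x \<in> carrier A - {\<one>\<^bsub>A\<^esub>}. c \<preceq>\<^bsub>A\<^esub> x \<longrightarrow> x = c)"

text \<open>
  In an infinite pocrim a unique coatom need not lie above all elements other than the top (as in
  the product of the Goedel algebras \<open>[0,1]\<close> and \<open>{0,1}\<close>), and coatoms need not exist (as in
  \<open>[0,1]\<close>). Coatomicity, which is automatic for finite pocrims, excludes both.
\<close>

definition coatomic :: "('a, 'm) pocrim_scheme \<Rightarrow> bool" where
  "coatomic A \<longleftrightarrow> (\<forall>x \<in> carrier A - {\<one>\<^bsub>A\<^esub>}. \<exists>c. coatom A c \<and> x \<preceq>\<^bsub>A\<^esub> c)"

text \<open>The sets \<open>x \<squnion> y\<close> and \<open>x \<sqinter> y\<close> of minimal upper and maximal lower bounds of two elements.\<close>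

definition mjoin :: "('a, 'm) pocrim_scheme \<Rightarrow> 'a \<Rightarrow> 'a \<Rightarrow> 'a set" where
  "mjoin A x y = min_upper (poset_of A) {x, y}"

definition mmeet :: "('a, 'm) pocrim_scheme \<Rightarrow> 'a \<Rightarrow> 'a \<Rightarrow> 'a set" where
  "mmeet A x y = max_lower (poset_of A) {x, y}"

definition full_submultilattice :: "('a, 'm) pocrim_scheme \<Rightarrow> 'a set \<Rightarrow> bool" where
  "full_submultilattice A X \<longleftrightarrow> X \<subseteq> carrier A \<and> \<one>\<^bsub>A\<^esub> \<in> X \<and>
     (\<forall>x \<in> X. \<forall>y \<in> X. x \<otimes>\<^bsub>A\<^esub> y \<in> X \<and> x \<leadsto>\<^bsub>A\<^esub> y \<in> X \<and> mjoin A x y \<subseteq> X \<and> mmeet A x y \<subseteq> X)"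


section \<open>Deductive systems, filters and quotients\<close>

definition deductive_system :: "('a, 'm) pocrim_scheme \<Rightarrow> 'a set \<Rightarrow> bool" where
  "deductive_system A F \<longleftrightarrow> F \<subseteq> carrier A \<and> \<one>\<^bsub>A\<^esub> \<in> F \<and>
     (\<forall>x \<in> F. \<forall>y \<in> carrier A. x \<leadsto>\<^bsub>A\<^esub> y \<in> F \<longrightarrow> y \<in> F)"

definition rml_filter :: "('a, 'm) pocrim_scheme \<Rightarrow> 'a set \<Rightarrow> bool" where
  "rml_filter A F \<longleftrightarrow> deductive_system A F \<and>
     (\<forall>x \<in> carrier A. \<forall>y \<in> carrier A. x \<leadsto>\<^bsub>A\<^esub> y \<in> F \<longrightarrow>
        (\<lambda>t. t \<leadsto>\<^bsub>A\<^esub> y) ` mjoin A x y \<subseteq> F \<and> (\<lambda>t. x \<leadsto>\<^bsub>A\<^esub> t) ` mmeet A x y \<subseteq> F)"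

definition consistent :: "('a, 'm) pocrim_scheme \<Rightarrow> 'a set \<Rightarrow> bool" where
  "consistent A F \<longleftrightarrow> deductive_system A F \<and>
     (\<forall>x \<in> carrier A. \<forall>y \<in> carrier A. \<forall>z \<in> carrier A.
        (x \<leadsto>\<^bsub>A\<^esub> z \<in> F \<and> y \<leadsto>\<^bsub>A\<^esub> z \<in> F \<longrightarrow> (\<lambda>t. t \<leadsto>\<^bsub>A\<^esub> z) ` mjoin A x y \<subseteq> F) \<and>
        (z \<leadsto>\<^bsub>A\<^esub> x \<in> F \<and> z \<leadsto>\<^bsub>A\<^esub> y \<in> F \<longrightarrow> (\<lambda>t. z \<leadsto>\<^bsub>A\<^esub> t) ` mmeet A x y \<subseteq> F))"

definition filter_rel :: "('a, 'm) pocrim_scheme \<Rightarrow> 'a set \<Rightarrow> ('a \<times> 'a) set" where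
  "filter_rel A F = {(x, y). x \<in> carrier A \<and> y \<in> carrier A \<and> x \<leadsto>\<^bsub>A\<^esub> y \<in> F \<and> y \<leadsto>\<^bsub>A\<^esub> x \<in> F}"

text \<open>
  Operations on classes are unions over all representatives, so that they are the class of the
  result when the relation is a congruence. The sets of minimal upper and maximal lower bounds
  in the quotient are those of its order, \<open>[x] \<le> [y]\<close> iff \<open>x \<leadsto> y \<in> F\<close>.
\<close>

definition quotient_pocrim :: "('a, 'm) pocrim_scheme \<Rightarrow> 'a set \<Rightarrow> 'a set pocrim" where
  "quotient_pocrim A F =
     \<lparr>carrier = carrier A // filter_rel A F,
      mult = (\<lambda>X Y. \<Union>x\<in>X. \<Union>y\<in>Y. filter_rel A F `` {x \<otimes>\<^bsub>A\<^esub> y}),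
      one = filter_rel A F `` {\<one>\<^bsub>A\<^esub>},
      leq = (\<lambda>X Y. \<exists>x\<in>X. \<exists>y\<in>Y. x \<leadsto>\<^bsub>A\<^esub> y \<in> F),
      imp = (\<lambda>X Y. \<Union>x\<in>X. \<Union>y\<in>Y. filter_rel A F `` {x \<leadsto>\<^bsub>A\<^esub> y})\<rparr>"

definition rml_hom :: "('a, 'm) pocrim_scheme \<Rightarrow> ('b, 'n) pocrim_scheme \<Rightarrow> ('a \<Rightarrow> 'b) set" where
  "rml_hom A B = {h \<in> hom A B. \<forall>x \<in> carrier A. \<forall>y \<in> carrier A.
     h ` mjoin A x y \<subseteq> mjoin B (h x) (h y) \<and>
     h ` mmeet A x y \<subseteq> mmeet B (h x) (h y) \<and>
     h (x \<leadsto>\<^bsub>A\<^esub> y) = h x \<leadsto>\<^bsub>B\<^esub> h y}"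

definition rml_iso :: "('a, 'm) pocrim_scheme \<Rightarrow> ('b, 'n) pocrim_scheme \<Rightarrow> ('a \<Rightarrow> 'b) set" where
  "rml_iso A B = {h \<in> rml_hom A B. bij_betw h (carrier A) (carrier B)}"


section \<open>Ordinal sums\<close>

text \<open>
  Both tops are represented by the top of the second summand: the first summand \<open>M\<close> contributes
  \<open>Inl x\<close> for \<open>x \<noteq> \<one>\<^bsub>M\<^esub>\<close>, the second one \<open>N\<close> contributes \<open>Inr y\<close> for all \<open>y\<close>. The common top
  belongs to both summands; the clauses given for it by \<open>M\<close> and by \<open>N\<close> agree, so that
  it is enough to treat it as an element of \<open>N\<close>.
\<close>

definition osum_inl :: "('a, 'm) pocrim_scheme \<Rightarrow> ('b, 'n) pocrim_scheme \<Rightarrow> 'a \<Rightarrow> 'a + 'b" where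
  "osum_inl M N x = (if x = \<one>\<^bsub>M\<^esub> then Inr \<one>\<^bsub>N\<^esub> else Inl x)"

fun osum_leq ::
  "('a, 'm) pocrim_scheme \<Rightarrow> ('b, 'n) pocrim_scheme \<Rightarrow> 'a + 'b \<Rightarrow> 'a + 'b \<Rightarrow> bool" where
  "osum_leq M N (Inl x) (Inl y) \<longleftrightarrow> x \<preceq>\<^bsub>M\<^esub> y"
| "osum_leq M N (Inr x) (Inr y) \<longleftrightarrow> x \<preceq>\<^bsub>N\<^esub> y"
| "osum_leq M N (Inl x) (Inr y) \<longleftrightarrow> True"
| "osum_leq M N (Inr x) (Inl y) \<longleftrightarrow> False"

fun osum_mult ::
  "('a, 'm) pocrim_scheme \<Rightarrow> ('b, 'n) pocrim_scheme \<Rightarrow> 'a + 'b \<Rightarrow> 'a + 'b \<Rightarrow> 'a + 'b" where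
  "osum_mult M N (Inl x) (Inl y) = osum_inl M N (x \<otimes>\<^bsub>M\<^esub> y)"
| "osum_mult M N (Inr x) (Inr y) = Inr (x \<otimes>\<^bsub>N\<^esub> y)"
| "osum_mult M N (Inl x) (Inr y) = Inl x"
| "osum_mult M N (Inr x) (Inl y) = Inl y"

fun osum_imp ::
  "('a, 'm) pocrim_scheme \<Rightarrow> ('b, 'n) pocrim_scheme \<Rightarrow> 'a + 'b \<Rightarrow> 'a + 'b \<Rightarrow> 'a + 'b" where
  "osum_imp M N (Inl x) (Inl y) = osum_inl M N (x \<leadsto>\<^bsub>M\<^esub> y)"
| "osum_imp M N (Inr x) (Inr y) = Inr (x \<leadsto>\<^bsub>N\<^esub> y)"
| "osum_imp M N (Inl x) (Inr y) = Inr \<one>\<^bsub>N\<^esub>"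
| "osum_imp M N (Inr x) (Inl y) = Inl y"

definition ordinal_sum ::
  "('a, 'm) pocrim_scheme \<Rightarrow> ('b, 'n) pocrim_scheme \<Rightarrow> ('a + 'b) pocrim" where
  "ordinal_sum M N =
     \<lparr>carrier = osum_inl M N ` carrier M \<union> Inr ` carrier N,
      mult = osum_mult M N,
      one = Inr \<one>\<^bsub>N\<^esub>,
      leq = osum_leq M N,
      imp = osum_imp M N\<rparr>"

end

theory Submission
  imports Defs
begin

text \<open>
  The ordinal sum \<open>S\<close> of \<open>M\<close> and \<open>N\<close> puts the elements of \<open>M\<close> other than the top below all of
  \<open>N\<close>. The bounds of a set with elements in both summands are therefore decided by one of them:
  upper bounds by its part in \<open>N\<close>, lower bounds by its part in \<open>M\<close>. For a nonempty set of
  elements of \<open>N\<close>, or of elements of \<open>M\<close> other than the top, minimal upper and maximal lower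
  bounds in \<open>S\<close> are those of the summand (\<open>min_upper_Inr\<close>, \<open>min_upper_Inl\<close>,
  \<open>max_lower_Inl\<close>, \<open>max_lower_Inr\<close>), with a single exception: a set of the second kind whose
  only upper bound in \<open>M\<close> is the top has all of \<open>N\<close> as upper bounds in \<open>S\<close>, and its only minimal one is the bottom of \<open>N\<close> (\<open>min_upper_Inl_top\<close>). So \<open>S\<close> is
  a multilattice, and \<open>N\<close> is closed under all operations.

  The exception is the reason for the condition on coatoms. Two different coatoms of \<open>M\<close> have
  no common upper bound but the top, so that their join in \<open>S\<close> is the bottom of \<open>N\<close>, which lies
  outside \<open>M\<close> unless \<open>N\<close> is trivial. If a single coatom lies above everything other than the top,
  then the exception does not arise for two such elements, and \<open>M\<close> is closed under joins.

  The map \<open>proj\<close> that is the identity on \<open>M\<close> and sends \<open>N\<close> to the top of \<open>M\<close> preserves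
  multiplication and implication, is onto, and has kernel \<open>N\<close>. Hence \<open>N\<close> is a deductive
  system with \<open>x \<leadsto> y \<in> N\<close> iff \<open>proj x \<le> proj y\<close>, and the quotient by \<open>N\<close> is a copy of \<open>M\<close>
  by the first isomorphism theorem. Its elements are the fibres of \<open>proj\<close>, so the structure of \<open>M\<close>
  is carried over to it along a bijection (\<open>pocrim_bijection\<close>, \<open>quotient_bijection\<close>).

  Under this description of \<open>x \<leadsto> y \<in> N\<close>, consistency of \<open>N\<close> says that every minimal upper
  bound of \<open>x\<close> and \<open>y\<close> is mapped below all upper bounds of \<open>proj x\<close> and \<open>proj y\<close>, and dually
  (\<open>consistent_N_iff\<close>). For \<open>x\<close> and \<open>y\<close> in \<open>M\<close> this makes minimal upper bounds least and
  maximal lower bounds greatest, which is the lattice property. The bottom of \<open>M\<close> supplies the lower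
  bound needed for a maximal one to exist.
\<close>

section \<open>Bounds in pocrims\<close>

lemma poset_of_simps [simp]:
  "carrier (poset_of A) = carrier A" "le (poset_of A) = leq A" "eq (poset_of A) = (=)"
  by (simp_all add: poset_of_def)

lemma mem_Upper_iff:
  "u \<in> Upper (poset_of A) X \<longleftrightarrow> u \<in> carrier A \<and> (\<forall>x \<in> X \<inter> carrier A. x \<preceq>\<^bsub>A\<^esub> u)"
  by (auto simp: Upper_def)

lemma mem_Lower_iff:
  "l \<in> Lower (poset_of A) X \<longleftrightarrow> l \<in> carrier A \<and> (\<forall>x \<in> X \<inter> carrier A. l \<preceq>\<^bsub>A\<^esub> x)"
  by (auto simp: Lower_def)

lemma mem_min_upper_iff:
  "u \<in> min_upper (poset_of A) X \<longleftrightarrow> u \<in> Upper (poset_of A) X \<and>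
     (\<forall>v \<in> Upper (poset_of A) X. v \<preceq>\<^bsub>A\<^esub> u \<longrightarrow> v = u)"
  by (auto simp: min_upper_def)

lemma mem_max_lower_iff:
  "l \<in> max_lower (poset_of A) X \<longleftrightarrow> l \<in> Lower (poset_of A) X \<and>
     (\<forall>v \<in> Lower (poset_of A) X. l \<preceq>\<^bsub>A\<^esub> v \<longrightarrow> v = l)"
  by (auto simp: max_lower_def)

lemma mjoin_subset_carrier: "mjoin A x y \<subseteq> carrier A"
  by (auto simp: mjoin_def mem_min_upper_iff mem_Upper_iff)

lemma mmeet_subset_carrier: "mmeet A x y \<subseteq> carrier A"
  by (auto simp: mmeet_def mem_max_lower_iff mem_Lower_iff)

lemma partial_order_poset_ofI:
  assumes "\<And>x. x \<in> carrier A \<Longrightarrow> x \<preceq>\<^bsub>A\<^esub> x"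
    and "\<And>x y. \<lbrakk>x \<in> carrier A; y \<in> carrier A; x \<preceq>\<^bsub>A\<^esub> y; y \<preceq>\<^bsub>A\<^esub> x\<rbrakk> \<Longrightarrow> x = y"
    and "\<And>x y z. \<lbrakk>x \<in> carrier A; y \<in> carrier A; z \<in> carrier A; x \<preceq>\<^bsub>A\<^esub> y; y \<preceq>\<^bsub>A\<^esub> z\<rbrakk>
           \<Longrightarrow> x \<preceq>\<^bsub>A\<^esub> z"
  shows "partial_order (poset_of A)"
  by unfold_locales (auto intro: assms)

context pocrim
begin

lemma leq_refl: "x \<in> carrier A \<Longrightarrow> x \<preceq> x"
  using order.le_refl by simp

lemma leq_antisym: "\<lbrakk>x \<preceq> y; y \<preceq> x; x \<in> carrier A; y \<in> carrier A\<rbrakk> \<Longrightarrow> x = y"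
  using order.le_antisym by simp

lemma leq_trans:
  "\<lbrakk>x \<preceq> y; y \<preceq> z; x \<in> carrier A; y \<in> carrier A; z \<in> carrier A\<rbrakk> \<Longrightarrow> x \<preceq> z"
  using order.le_trans by simp

lemma one_leq_iff: "x \<in> carrier A \<Longrightarrow> \<one> \<preceq> x \<longleftrightarrow> x = \<one>"
  using leq_antisym leq_refl top_greatest by blast

lemma imp_eq_one_iff: "\<lbrakk>x \<in> carrier A; y \<in> carrier A\<rbrakk> \<Longrightarrow> x \<leadsto> y = \<one> \<longleftrightarrow> x \<preceq> y"
  using residuation[of x y \<one>] one_leq_iff[OF imp_closed] by simp

lemma imp_one: "x \<in> carrier A \<Longrightarrow> x \<leadsto> \<one> = \<one>"
  by (simp add: imp_eq_one_iff top_greatest)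

lemma one_imp:
  assumes "x \<in> carrier A"
  shows "\<one> \<leadsto> x = x"
proof (rule leq_antisym)
  show "\<one> \<leadsto> x \<preceq> x"
    using residuation[of \<one> x "\<one> \<leadsto> x"] assms imp_closed leq_refl by simp
  show "x \<preceq> \<one> \<leadsto> x"
    using residuation[of \<one> x x] assms leq_refl by simp
qed (use assms imp_closed in auto)

lemma mult_leq: "\<lbrakk>x \<in> carrier A; y \<in> carrier A\<rbrakk> \<Longrightarrow> x \<otimes> y \<preceq> x"
  by (metis imp_eq_one_iff leq_refl residuation top_greatest)

lemma mult_neq_one: "\<lbrakk>x \<in> carrier A; y \<in> carrier A; x \<noteq> \<one>\<rbrakk> \<Longrightarrow> x \<otimes> y \<noteq> \<one>"
  using mult_leq[of x y] one_leq_iff by auto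

lemma min_upper_of_least:
  "least (poset_of A) l (Upper (poset_of A) X) \<Longrightarrow> min_upper (poset_of A) X = {l}"
proof -
  assume "least (poset_of A) l (Upper (poset_of A) X)"
  then have l: "l \<in> Upper (poset_of A) X" "\<And>u. u \<in> Upper (poset_of A) X \<Longrightarrow> l \<preceq> u"
    by (simp_all add: least_def)
  moreover have "Upper (poset_of A) X \<subseteq> carrier A"
    by (auto simp: mem_Upper_iff)
  ultimately have "v = l" if "v \<in> Upper (poset_of A) X" "v \<preceq> l" for v
    using that by (meson leq_antisym subsetD)
  then show ?thesis
    using l unfolding min_upper_def by auto
qed

lemma max_lower_of_greatest:
  "greatest (poset_of A) l (Lower (poset_of A) X) \<Longrightarrow> max_lower (poset_of A) X = {l}"
proof -
  assume "greatest (poset_of A) l (Lower (poset_of A) X)"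
  then have l: "l \<in> Lower (poset_of A) X" "\<And>u. u \<in> Lower (poset_of A) X \<Longrightarrow> u \<preceq> l"
    by (simp_all add: greatest_def)
  moreover have "Lower (poset_of A) X \<subseteq> carrier A"
    by (auto simp: mem_Lower_iff)
  ultimately have "v = l" if "v \<in> Lower (poset_of A) X" "l \<preceq> v" for v
    using that by (meson leq_antisym subsetD)
  then show ?thesis
    using l unfolding max_lower_def by auto
qed

lemma mjoin_of_leq:
  assumes "x \<preceq> y" "x \<in> carrier A" "y \<in> carrier A"
  shows "mjoin A x y = {y}"
  unfolding mjoin_def using assms leq_refl
  by (intro min_upper_of_least) (auto simp: least_def mem_Upper_iff)

lemma mmeet_of_leq:
  assumes "x \<preceq> y" "x \<in> carrier A" "y \<in> carrier A"
  shows "mmeet A x y = {x}"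
  unfolding mmeet_def using assms leq_refl
  by (intro max_lower_of_greatest) (auto simp: greatest_def mem_Lower_iff)

lemma mjoin_commute: "mjoin A x y = mjoin A y x"
  by (simp add: mjoin_def insert_commute)

lemma mmeet_commute: "mmeet A x y = mmeet A y x"
  by (simp add: mmeet_def insert_commute)

end

lemma has_bottomE:
  assumes "has_bottom A"
  obtains b where "b \<in> carrier A" "\<And>x. x \<in> carrier A \<Longrightarrow> b \<preceq>\<^bsub>A\<^esub> x"
  using assms by (auto simp: has_bottom_def least_def)


section \<open>Transport of structure and quotients by kernels\<close>

text \<open>
  \<open>B\<close> is only known through its operations. That it is a pocrim is a consequence of the bijection
  (\<open>pocrim_image\<close>), which is how the quotient is shown to be one.
\<close>

locale pocrim_bijection = A: pocrim A
  for A :: "('a, 'm) pocrim_scheme" and B :: "('b, 'n) pocrim_scheme" and f :: "'a \<Rightarrow> 'b" +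
  assumes bij: "bij_betw f (carrier A) (carrier B)"
    and f_one: "f \<one>\<^bsub>A\<^esub> = \<one>\<^bsub>B\<^esub>"
    and f_mult: "\<And>x y. \<lbrakk>x \<in> carrier A; y \<in> carrier A\<rbrakk> \<Longrightarrow> f (x \<otimes>\<^bsub>A\<^esub> y) = f x \<otimes>\<^bsub>B\<^esub> f y"
    and f_imp: "\<And>x y. \<lbrakk>x \<in> carrier A; y \<in> carrier A\<rbrakk> \<Longrightarrow> f (x \<leadsto>\<^bsub>A\<^esub> y) = f x \<leadsto>\<^bsub>B\<^esub> f y"
    and f_leq: "\<And>x y. \<lbrakk>x \<in> carrier A; y \<in> carrier A\<rbrakk> \<Longrightarrow> f x \<preceq>\<^bsub>B\<^esub> f y \<longleftrightarrow> x \<preceq>\<^bsub>A\<^esub> y"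
begin

lemma carrier_eq: "carrier B = f ` carrier A"
  using bij by (simp add: bij_betw_def)

lemma f_eq_iff: "\<lbrakk>x \<in> carrier A; y \<in> carrier A\<rbrakk> \<Longrightarrow> f x = f y \<longleftrightarrow> x = y"
  using bij by (auto simp: bij_betw_def inj_on_def)

lemma pocrim_image: "pocrim B"
proof -
  have "comm_monoid B"
    by (rule comm_monoidI)
      (auto simp: carrier_eq f_one[symmetric] f_mult[symmetric] A.m_ac)
  moreover have "partial_order (poset_of B)"
    by (rule partial_order_poset_ofI)
      (auto simp: carrier_eq f_leq f_eq_iff A.leq_refl intro: A.leq_antisym A.leq_trans)
  moreover have "pocrim_axioms B"
    by unfold_locales
      (auto simp: carrier_eq f_one[symmetric] f_mult[symmetric] f_imp[symmetric] f_leq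
        A.top_greatest A.imp_closed A.residuation)
  ultimately show ?thesis
    by (rule pocrim.intro)
qed

lemma Upper_image:
  assumes "X \<subseteq> carrier A"
  shows "Upper (poset_of B) (f ` X) = f ` Upper (poset_of A) X"
proof -
  have "f ` X \<inter> carrier B = f ` X"
    using assms by (auto simp: carrier_eq)
  then have "u \<in> Upper (poset_of B) (f ` X) \<longleftrightarrow> u \<in> carrier B \<and> (\<forall>x \<in> X. f x \<preceq>\<^bsub>B\<^esub> u)" for u
    by (simp add: mem_Upper_iff)
  then have "Upper (poset_of B) (f ` X) = f ` {u \<in> carrier A. \<forall>x \<in> X. f x \<preceq>\<^bsub>B\<^esub> f u}"
    by (auto simp: carrier_eq)
  also have "{u \<in> carrier A. \<forall>x \<in> X. f x \<preceq>\<^bsub>B\<^esub> f u} = Upper (poset_of A) X"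
    using assms by (auto simp: mem_Upper_iff f_leq subset_iff)
  finally show ?thesis .
qed

lemma Lower_image:
  assumes "X \<subseteq> carrier A"
  shows "Lower (poset_of B) (f ` X) = f ` Lower (poset_of A) X"
proof -
  have "f ` X \<inter> carrier B = f ` X"
    using assms by (auto simp: carrier_eq)
  then have "l \<in> Lower (poset_of B) (f ` X) \<longleftrightarrow> l \<in> carrier B \<and> (\<forall>x \<in> X. l \<preceq>\<^bsub>B\<^esub> f x)" for l
    by (simp add: mem_Lower_iff)
  then have "Lower (poset_of B) (f ` X) = f ` {l \<in> carrier A. \<forall>x \<in> X. f l \<preceq>\<^bsub>B\<^esub> f x}"
    by (auto simp: carrier_eq)
  also have "{l \<in> carrier A. \<forall>x \<in> X. f l \<preceq>\<^bsub>B\<^esub> f x} = Lower (poset_of A) X"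
    using assms by (auto simp: mem_Lower_iff f_leq subset_iff)
  finally show ?thesis .
qed

lemma min_upper_image:
  "X \<subseteq> carrier A \<Longrightarrow> min_upper (poset_of B) (f ` X) = f ` min_upper (poset_of A) X"
  by (auto simp: mem_min_upper_iff Upper_image mem_Upper_iff f_leq f_eq_iff)

lemma max_lower_image:
  "X \<subseteq> carrier A \<Longrightarrow> max_lower (poset_of B) (f ` X) = f ` max_lower (poset_of A) X"
  by (auto simp: mem_max_lower_iff Lower_image mem_Lower_iff f_leq f_eq_iff)

lemma residuated_multilattice_image:
  assumes "residuated_multilattice A"
  shows "residuated_multilattice B"
proof -
  interpret A: residuated_multilattice A by fact
  interpret B: pocrim B by (rule pocrim_image)
  have preimage: "\<exists>X. finite X \<and> X \<subseteq> carrier A \<and> Y = f ` X"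
    if "finite Y" "Y \<subseteq> carrier B" for Y
    using that by (metis carrier_eq finite_subset_image)
  show ?thesis
  proof unfold_locales
    fix Y u assume "finite Y" "Y \<subseteq> carrier (poset_of B)" "u \<in> Upper (poset_of B) Y"
    then obtain X v where X: "finite X" "X \<subseteq> carrier A" "Y = f ` X"
      and v: "v \<in> Upper (poset_of A) X" "u = f v"
      using preimage by (metis Upper_image imageE poset_of_simps(1))
    then obtain m where "m \<in> min_upper (poset_of A) X" "m \<preceq>\<^bsub>A\<^esub> v"
      using A.min_upper_below[of X v] by auto
    then show "\<exists>m \<in> min_upper (poset_of B) Y. m \<sqsubseteq>\<^bsub>poset_of B\<^esub> u"
      using X v by (auto simp: min_upper_image mem_min_upper_iff mem_Upper_iff f_leq)
  next
    fix Y l assume "finite Y" "Y \<subseteq> carrier (poset_of B)" "l \<in> Lower (poset_of B) Y"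
    then obtain X v where X: "finite X" "X \<subseteq> carrier A" "Y = f ` X"
      and v: "v \<in> Lower (poset_of A) X" "l = f v"
      using preimage by (metis Lower_image imageE poset_of_simps(1))
    then obtain m where "m \<in> max_lower (poset_of A) X" "v \<preceq>\<^bsub>A\<^esub> m"
      using A.max_lower_above[of X v] by auto
    then show "\<exists>m \<in> max_lower (poset_of B) Y. l \<sqsubseteq>\<^bsub>poset_of B\<^esub> m"
      using X v by (auto simp: max_lower_image mem_max_lower_iff mem_Lower_iff f_leq)
  qed
qed

text \<open>
  Both directions of an order isomorphism preserve the sets of minimal upper and maximal lower
  bounds. The inverse is singled out because the canonical map leads from the quotient to \<open>M\<close>,
  while the fibre map leads from \<open>M\<close> to the quotient.
\<close>

lemma inv_into_rml_iso: "inv_into (carrier A) f \<in> rml_iso B A"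
proof -
  let ?g = "inv_into (carrier A) f"
  have g: "?g (f x) = x" if "x \<in> carrier A" for x
    using bij that by (simp add: bij_betw_def)
  have g_image: "?g ` f ` X = X" if "X \<subseteq> carrier A" for X
    using bij that by (simp add: bij_betw_def inv_into_image_cancel)
  have mjoin: "?g ` mjoin B (f x) (f y) = mjoin A x y"
    and mmeet: "?g ` mmeet B (f x) (f y) = mmeet A x y"
    if "x \<in> carrier A" "y \<in> carrier A" for x y
  proof -
    have "mjoin B (f x) (f y) = f ` mjoin A x y" "mmeet B (f x) (f y) = f ` mmeet A x y"
      using that min_upper_image[of "{x, y}"] max_lower_image[of "{x, y}"]
      by (simp_all add: mjoin_def mmeet_def)
    then show "?g ` mjoin B (f x) (f y) = mjoin A x y"
      "?g ` mmeet B (f x) (f y) = mmeet A x y"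
      by (simp_all add: g_image mjoin_subset_carrier mmeet_subset_carrier)
  qed
  have "?g \<in> hom B A"
    by (auto simp: hom_def carrier_eq g f_mult[symmetric])
  moreover have "bij_betw ?g (carrier B) (carrier A)"
    using bij by (rule bij_betw_inv_into)
  ultimately show ?thesis
    by (auto simp: rml_iso_def rml_hom_def carrier_eq g mjoin mmeet f_imp[symmetric] A.imp_closed
        simp flip: image_comp)
qed

end

locale pocrim_epimorphism = A: pocrim A + B: pocrim B
  for A :: "('a, 'm) pocrim_scheme" and B :: "('b, 'n) pocrim_scheme" +
  fixes p :: "'a \<Rightarrow> 'b"
  assumes p_onto: "p ` carrier A = carrier B"
    and p_mult: "\<And>x y. \<lbrakk>x \<in> carrier A; y \<in> carrier A\<rbrakk> \<Longrightarrow> p (x \<otimes>\<^bsub>A\<^esub> y) = p x \<otimes>\<^bsub>B\<^esub> p y"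
    and p_imp: "\<And>x y. \<lbrakk>x \<in> carrier A; y \<in> carrier A\<rbrakk> \<Longrightarrow> p (x \<leadsto>\<^bsub>A\<^esub> y) = p x \<leadsto>\<^bsub>B\<^esub> p y"
begin

definition kernel :: "'a set" where
  "kernel = {x \<in> carrier A. p x = \<one>\<^bsub>B\<^esub>}"

definition fibre :: "'b \<Rightarrow> 'a set" where
  "fibre b = {x \<in> carrier A. p x = b}"

lemma p_closed: "x \<in> carrier A \<Longrightarrow> p x \<in> carrier B"
  using p_onto by auto

text \<open>The top is expressible by implication, as \<open>x \<leadsto> x\<close> or \<open>x \<leadsto> \<one>\<close>.\<close>

lemma p_one: "p \<one>\<^bsub>A\<^esub> = \<one>\<^bsub>B\<^esub>"
  by (metis A.imp_one A.one_closed B.imp_eq_one_iff B.leq_refl p_closed p_imp)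

lemma imp_in_kernel_iff:
  "\<lbrakk>x \<in> carrier A; y \<in> carrier A\<rbrakk> \<Longrightarrow> x \<leadsto>\<^bsub>A\<^esub> y \<in> kernel \<longleftrightarrow> p x \<preceq>\<^bsub>B\<^esub> p y"
  by (simp add: kernel_def A.imp_closed p_imp B.imp_eq_one_iff p_closed)

lemma filter_rel_kernel:
  "filter_rel A kernel = {(x, y). x \<in> carrier A \<and> y \<in> carrier A \<and> p x = p y}"
  by (auto simp: filter_rel_def imp_in_kernel_iff p_closed B.leq_refl intro: B.leq_antisym)

lemma filter_rel_kernel_class: "x \<in> carrier A \<Longrightarrow> filter_rel A kernel `` {x} = fibre (p x)"
  by (auto simp: filter_rel_kernel fibre_def)

lemma fibre_nonempty: "b \<in> carrier B \<Longrightarrow> \<exists>x. x \<in> fibre b"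
  by (auto simp: fibre_def simp flip: p_onto)

text \<open>
  The operations of the quotient are unions over representatives, which collapse when the
  terms agree. The fibres have to be nonempty for the union to be that common value.
\<close>

lemma UN_fibres_eq:
  assumes "a \<in> carrier B" "b \<in> carrier B"
    and "\<And>x y. \<lbrakk>x \<in> fibre a; y \<in> fibre b\<rbrakk> \<Longrightarrow> g x y = C"
  shows "(\<Union>x \<in> fibre a. \<Union>y \<in> fibre b. g x y) = C"
  using assms fibre_nonempty by fastforce

text \<open>
  The first isomorphism theorem: the classes of the kernel relation are the fibres, and
  \<open>filter_rel\<close> is a congruence because it is equality of images under a homomorphism.
\<close>

lemma quotient_bijection: "pocrim_bijection B (quotient_pocrim A kernel) fibre"
proof unfold_locales
  have "inj_on fibre (carrier B)"
    using fibre_nonempty by (fastforce simp: inj_on_def fibre_def)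
  moreover have "carrier A // filter_rel A kernel = fibre ` carrier B"
    unfolding quotient_def p_onto[symmetric] by (auto simp: filter_rel_kernel_class)
  ultimately show "bij_betw fibre (carrier B) (carrier (quotient_pocrim A kernel))"
    by (simp add: bij_betw_def quotient_pocrim_def)
  show "fibre \<one>\<^bsub>B\<^esub> = \<one>\<^bsub>quotient_pocrim A kernel\<^esub>"
    by (simp add: quotient_pocrim_def filter_rel_kernel_class p_one)
next
  fix a b assume ab: "a \<in> carrier B" "b \<in> carrier B"
  show "fibre (a \<otimes>\<^bsub>B\<^esub> b) = fibre a \<otimes>\<^bsub>quotient_pocrim A kernel\<^esub> fibre b"
    unfolding quotient_pocrim_def
    by (simp, rule UN_fibres_eq[symmetric]) (use ab in \<open>auto simp: fibre_def p_mult filter_rel_kernel\<close>)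
  show "fibre (a \<leadsto>\<^bsub>B\<^esub> b) = fibre a \<leadsto>\<^bsub>quotient_pocrim A kernel\<^esub> fibre b"
    unfolding quotient_pocrim_def
    by (simp, rule UN_fibres_eq[symmetric])
      (use ab in \<open>auto simp: fibre_def p_imp A.imp_closed filter_rel_kernel\<close>)
  have "x \<leadsto>\<^bsub>A\<^esub> y \<in> kernel \<longleftrightarrow> a \<preceq>\<^bsub>B\<^esub> b" if "x \<in> fibre a" "y \<in> fibre b" for x y
    using that imp_in_kernel_iff by (auto simp: fibre_def)
  then show "fibre a \<preceq>\<^bsub>quotient_pocrim A kernel\<^esub> fibre b \<longleftrightarrow> a \<preceq>\<^bsub>B\<^esub> b"
    using fibre_nonempty ab by (fastforce simp: quotient_pocrim_def)
qed

lemma quotient_residuated_multilattice: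
  assumes "residuated_multilattice B"
  shows "residuated_multilattice (quotient_pocrim A kernel)"
  using pocrim_bijection.residuated_multilattice_image[OF quotient_bijection assms] .

lemma quotient_isomorphism:
  "\<exists>h \<in> rml_iso (quotient_pocrim A kernel) B.
     \<forall>x \<in> carrier A. h (filter_rel A kernel `` {x}) = p x"
proof -
  interpret q: pocrim_bijection B "quotient_pocrim A kernel" fibre
    by (rule quotient_bijection)
  have "inv_into (carrier B) fibre (filter_rel A kernel `` {x}) = p x" if "x \<in> carrier A" for x
    using that q.bij by (simp add: filter_rel_kernel_class p_closed bij_betw_def)
  then show ?thesis
    using q.inv_into_rml_iso by blast
qed

end


section \<open>The ordinal sum as a pocrim\<close>

locale ordinal_summands = M: pocrim M + N: pocrim N
  for M :: "('a, 'm) pocrim_scheme" and N :: "('b, 'n) pocrim_scheme"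
begin

abbreviation S :: "('a + 'b) pocrim" where
  "S \<equiv> ordinal_sum M N"

lemma S_simps [simp]:
  "Inl x \<in> carrier S \<longleftrightarrow> x \<in> carrier M \<and> x \<noteq> \<one>\<^bsub>M\<^esub>"
  "Inr y \<in> carrier S \<longleftrightarrow> y \<in> carrier N"
  "mult S = osum_mult M N" "one S = Inr \<one>\<^bsub>N\<^esub>" "leq S = osum_leq M N" "imp S = osum_imp M N"
  by (auto simp: ordinal_sum_def osum_inl_def)

lemma ball_carrier_S:
  "(\<forall>z \<in> carrier S. P z) \<longleftrightarrow>
     (\<forall>x \<in> carrier M - {\<one>\<^bsub>M\<^esub>}. P (Inl x)) \<and> (\<forall>y \<in> carrier N. P (Inr y))"
  by (metis DiffD1 DiffD2 DiffI S_simps(1,2) insertI1 old.sum.exhaust singletonD)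

lemma osum_inl_closed: "x \<in> carrier M \<Longrightarrow> osum_inl M N x \<in> carrier S"
  by (simp add: osum_inl_def)

lemma S_comm_monoid: "comm_monoid S"
proof (rule comm_monoidI)
  fix x y z assume "x \<in> carrier S" "y \<in> carrier S" "z \<in> carrier S"
  then show "x \<otimes>\<^bsub>S\<^esub> y \<otimes>\<^bsub>S\<^esub> z = x \<otimes>\<^bsub>S\<^esub> (y \<otimes>\<^bsub>S\<^esub> z)"
    by (cases x; cases y; cases z)
      (auto simp: osum_inl_def M.m_assoc N.m_assoc M.mult_neq_one)
next
  fix x y assume "x \<in> carrier S" "y \<in> carrier S"
  then show "x \<otimes>\<^bsub>S\<^esub> y \<in> carrier S" "x \<otimes>\<^bsub>S\<^esub> y = y \<otimes>\<^bsub>S\<^esub> x"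
    by (cases x; cases y; auto simp: osum_inl_def M.m_comm N.m_comm)+
next
  fix x assume "x \<in> carrier S"
  then show "\<one>\<^bsub>S\<^esub> \<otimes>\<^bsub>S\<^esub> x = x"
    by (cases x) auto
qed simp

lemma S_partial_order: "partial_order (poset_of S)"
proof (rule partial_order_poset_ofI)
  fix x assume "x \<in> carrier S"
  then show "x \<preceq>\<^bsub>S\<^esub> x"
    by (cases x) (auto simp: M.leq_refl N.leq_refl)
next
  fix x y assume "x \<in> carrier S" "y \<in> carrier S" "x \<preceq>\<^bsub>S\<^esub> y" "y \<preceq>\<^bsub>S\<^esub> x"
  then show "x = y"
    by (cases x; cases y) (auto intro: M.leq_antisym N.leq_antisym)
next
  fix x y z assume "x \<in> carrier S" "y \<in> carrier S" "z \<in> carrier S" "x \<preceq>\<^bsub>S\<^esub> y" "y \<preceq>\<^bsub>S\<^esub> z"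
  then show "x \<preceq>\<^bsub>S\<^esub> z"
    by (cases x; cases y; cases z) (auto intro: M.leq_trans N.leq_trans)
qed

text \<open>
  The mixed cases of residuation hold since a product with a factor in \<open>M\<close> other than the top stays
  strictly below \<open>N\<close> (\<open>mult_neq_one\<close>), and since an implication between elements of \<open>M\<close>
  leaves the first summand precisely when its value is the top.
\<close>

lemma S_pocrim_axioms: "pocrim_axioms S"
proof
  fix x assume "x \<in> carrier S"
  then show "x \<preceq>\<^bsub>S\<^esub> \<one>\<^bsub>S\<^esub>"
    by (cases x) (auto simp: N.top_greatest)
next
  fix x y assume "x \<in> carrier S" "y \<in> carrier S"
  then show "x \<leadsto>\<^bsub>S\<^esub> y \<in> carrier S"
    by (cases x; cases y) (auto simp: osum_inl_def M.imp_closed N.imp_closed)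
next
  fix a b c assume "a \<in> carrier S" "b \<in> carrier S" "c \<in> carrier S"
  then show "a \<otimes>\<^bsub>S\<^esub> c \<preceq>\<^bsub>S\<^esub> b \<longleftrightarrow> c \<preceq>\<^bsub>S\<^esub> a \<leadsto>\<^bsub>S\<^esub> b"
    by (cases a; cases b; cases c)
      (auto simp: osum_inl_def M.residuation N.residuation N.top_greatest M.top_greatest
        M.one_leq_iff M.mult_neq_one, (metis M.imp_eq_one_iff M.top_greatest)+)
qed

sublocale S: pocrim S
  by (rule pocrim.intro[OF S_comm_monoid S_partial_order S_pocrim_axioms])

fun proj :: "'a + 'b \<Rightarrow> 'a" where
  "proj (Inl x) = x"
| "proj (Inr y) = \<one>\<^bsub>M\<^esub>"

text \<open>
  In the mixed cases an element of \<open>N\<close> acts in \<open>S\<close> on the elements of \<open>M\<close> as the top of \<open>M\<close>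
  does, by \<open>x \<leadsto> \<one> = \<one>\<close> and \<open>\<one> \<leadsto> x = x\<close>.
\<close>

sublocale proj: pocrim_epimorphism S M proj
proof
  show "proj ` carrier S = carrier M"
  proof
    show "proj ` carrier S \<subseteq> carrier M"
      by (auto simp: ball_carrier_S image_subset_iff)
    show "carrier M \<subseteq> proj ` carrier S"
    proof
      fix x assume "x \<in> carrier M"
      moreover have "proj (osum_inl M N x) = x"
        by (simp add: osum_inl_def)
      ultimately show "x \<in> proj ` carrier S"
        using osum_inl_closed by (metis image_eqI)
    qed
  qed
next
  fix x y assume "x \<in> carrier S" "y \<in> carrier S"
  then show "proj (x \<otimes>\<^bsub>S\<^esub> y) = proj x \<otimes>\<^bsub>M\<^esub> proj y"
    and "proj (x \<leadsto>\<^bsub>S\<^esub> y) = proj x \<leadsto>\<^bsub>M\<^esub> proj y"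
    by (cases x; cases y; auto simp: osum_inl_def M.imp_one M.one_imp)+
qed

lemma kernel_proj: "proj.kernel = Inr ` carrier N"
proof (rule Set.set_eqI)
  fix z show "z \<in> proj.kernel \<longleftrightarrow> z \<in> Inr ` carrier N"
    by (cases z) (auto simp: proj.kernel_def)
qed

lemma imp_in_N_iff:
  "\<lbrakk>x \<in> carrier S; y \<in> carrier S\<rbrakk>
     \<Longrightarrow> x \<leadsto>\<^bsub>S\<^esub> y \<in> Inr ` carrier N \<longleftrightarrow> proj x \<preceq>\<^bsub>M\<^esub> proj y"
  using proj.imp_in_kernel_iff by (simp only: kernel_proj)


section \<open>Minimal upper and maximal lower bounds in the ordinal sum\<close>

lemma ball_Int_carrier_S:
  "(\<forall>z \<in> (Inl ` X \<union> Inr ` Y) \<inter> carrier S. P z) \<longleftrightarrow>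
     (\<forall>x \<in> X. x \<in> carrier M \<and> x \<noteq> \<one>\<^bsub>M\<^esub> \<longrightarrow> P (Inl x)) \<and> (\<forall>y \<in> Y. y \<in> carrier N \<longrightarrow> P (Inr y))"
  by (auto simp: ball_Un)

text \<open>
  \<open>Upper\<close> and \<open>Lower\<close> disregard elements outside the carrier. Since \<open>Inl \<one>\<^bsub>M\<^esub>\<close> is one of
  them, \<open>\<one>\<^bsub>M\<^esub>\<close> has to be removed from \<open>X\<close>.
\<close>

lemma mem_Upper_S_iff:
  "Inl a \<in> Upper (poset_of S) (Inl ` X \<union> Inr ` Y) \<longleftrightarrow>
     Y \<inter> carrier N = {} \<and> a \<in> Upper (poset_of M) (X - {\<one>\<^bsub>M\<^esub>}) - {\<one>\<^bsub>M\<^esub>}"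
  "Inr b \<in> Upper (poset_of S) (Inl ` X \<union> Inr ` Y) \<longleftrightarrow> b \<in> Upper (poset_of N) Y"
  unfolding mem_Upper_iff[of _ S] ball_Int_carrier_S by (auto simp: mem_Upper_iff)

lemma mem_Lower_S_iff:
  "Inl a \<in> Lower (poset_of S) (Inl ` X \<union> Inr ` Y) \<longleftrightarrow>
     a \<in> Lower (poset_of M) (X - {\<one>\<^bsub>M\<^esub>}) - {\<one>\<^bsub>M\<^esub>}"
  "Inr b \<in> Lower (poset_of S) (Inl ` X \<union> Inr ` Y) \<longleftrightarrow>
     X \<inter> carrier M \<subseteq> {\<one>\<^bsub>M\<^esub>} \<and> b \<in> Lower (poset_of N) Y"
  unfolding mem_Lower_iff[of _ S] ball_Int_carrier_S by (auto simp: mem_Lower_iff)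

lemma Upper_Inr:
  assumes "Y \<noteq> {}" "Y \<subseteq> carrier N"
  shows "Upper (poset_of S) (Inl ` X \<union> Inr ` Y) = Inr ` Upper (poset_of N) Y"
proof (rule Set.set_eqI)
  have "Y \<inter> carrier N \<noteq> {}"
    using assms by blast
  then show "z \<in> Upper (poset_of S) (Inl ` X \<union> Inr ` Y) \<longleftrightarrow> z \<in> Inr ` Upper (poset_of N) Y" for z
    by (cases z) (auto simp: mem_Upper_S_iff)
qed

lemma Upper_Inl:
  assumes "X \<subseteq> carrier M - {\<one>\<^bsub>M\<^esub>}"
  shows "Upper (poset_of S) (Inl ` X) =
    Inl ` (Upper (poset_of M) X - {\<one>\<^bsub>M\<^esub>}) \<union> Inr ` carrier N"
proof (rule Set.set_eqI)
  have X: "X - {\<one>\<^bsub>M\<^esub>} = X"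
    using assms by blast
  fix z show "z \<in> Upper (poset_of S) (Inl ` X) \<longleftrightarrow>
      z \<in> Inl ` (Upper (poset_of M) X - {\<one>\<^bsub>M\<^esub>}) \<union> Inr ` carrier N"
    using mem_Upper_S_iff[of _ X "{}"] by (cases z) (auto simp: X mem_Upper_iff[of _ N])
qed

lemma Lower_Inl:
  assumes "X \<noteq> {}" "X \<subseteq> carrier M - {\<one>\<^bsub>M\<^esub>}"
  shows "Lower (poset_of S) (Inl ` X \<union> Inr ` Y) = Inl ` Lower (poset_of M) X"
proof (rule Set.set_eqI)
  obtain x where x: "x \<in> X" "x \<in> carrier M" "x \<noteq> \<one>\<^bsub>M\<^esub>"
    using assms by blast
  then have "\<one>\<^bsub>M\<^esub> \<notin> Lower (poset_of M) X"
    by (auto simp: mem_Lower_iff M.one_leq_iff)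
  moreover have "X - {\<one>\<^bsub>M\<^esub>} = X" "\<not> X \<inter> carrier M \<subseteq> {\<one>\<^bsub>M\<^esub>}"
    using assms x by blast+
  ultimately show "z \<in> Lower (poset_of S) (Inl ` X \<union> Inr ` Y) \<longleftrightarrow>
      z \<in> Inl ` Lower (poset_of M) X" for z
    by (cases z) (auto simp: mem_Lower_S_iff)
qed

lemma Lower_Inr:
  assumes "Y \<subseteq> carrier N"
  shows "Lower (poset_of S) (Inr ` Y) =
    Inl ` (carrier M - {\<one>\<^bsub>M\<^esub>}) \<union> Inr ` Lower (poset_of N) Y"
proof (rule Set.set_eqI)
  fix z show "z \<in> Lower (poset_of S) (Inr ` Y) \<longleftrightarrow>
      z \<in> Inl ` (carrier M - {\<one>\<^bsub>M\<^esub>}) \<union> Inr ` Lower (poset_of N) Y"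
    using mem_Lower_S_iff[of _ "{}" Y] by (cases z) (auto simp: mem_Lower_iff[of _ M])
qed

lemma min_upper_Inr:
  assumes "Y \<noteq> {}" "Y \<subseteq> carrier N"
  shows "min_upper (poset_of S) (Inl ` X \<union> Inr ` Y) = Inr ` min_upper (poset_of N) Y"
  by (auto simp: mem_min_upper_iff Upper_Inr[OF assms])

text \<open>
  An upper bound \<open>u\<close> other than the top lies below all of \<open>N\<close>, so that no element of \<open>N\<close> is a
  minimal upper bound, and neither is the top of \<open>M\<close>.
\<close>

lemma min_upper_Inl:
  assumes "X \<subseteq> carrier M - {\<one>\<^bsub>M\<^esub>}"
    and u: "u \<in> Upper (poset_of M) X" "u \<noteq> \<one>\<^bsub>M\<^esub>"
  shows "min_upper (poset_of S) (Inl ` X) = Inl ` min_upper (poset_of M) X"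
proof -
  have not_one: "\<one>\<^bsub>M\<^esub> \<notin> min_upper (poset_of M) X"
    using u M.top_greatest by (auto simp: mem_min_upper_iff mem_Upper_iff)
  show ?thesis
  proof (rule Set.set_eqI)
    fix z show "z \<in> min_upper (poset_of S) (Inl ` X) \<longleftrightarrow> z \<in> Inl ` min_upper (poset_of M) X"
    proof (cases z)
      case (Inl m)
      have "m \<in> min_upper (poset_of M) X" if "z \<in> min_upper (poset_of S) (Inl ` X)"
      proof -
        have m: "m \<in> Upper (poset_of M) X" "m \<noteq> \<one>\<^bsub>M\<^esub>"
          and minimal: "\<And>v. \<lbrakk>v \<in> Upper (poset_of M) X; v \<noteq> \<one>\<^bsub>M\<^esub>; v \<preceq>\<^bsub>M\<^esub> m\<rbrakk> \<Longrightarrow> v = m"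
          using that by (auto simp: Inl mem_min_upper_iff Upper_Inl[OF assms(1)] ball_Un)
        moreover have "\<not> \<one>\<^bsub>M\<^esub> \<preceq>\<^bsub>M\<^esub> m"
          using m by (simp add: mem_Upper_iff M.one_leq_iff)
        ultimately show ?thesis
          unfolding mem_min_upper_iff by blast
      qed
      moreover have "z \<in> min_upper (poset_of S) (Inl ` X)" if "m \<in> min_upper (poset_of M) X"
        using that not_one unfolding Inl
        by (auto simp: mem_min_upper_iff Upper_Inl[OF assms(1)])
      ultimately show ?thesis
        using Inl by auto
    next
      case (Inr n)
      then show ?thesis
        using u by (auto simp: mem_min_upper_iff Upper_Inl[OF assms(1)] ball_Un)
    qed
  qed
qed

lemma min_upper_Inl_top:
  assumes "X \<subseteq> carrier M - {\<one>\<^bsub>M\<^esub>}" "Upper (poset_of M) X \<subseteq> {\<one>\<^bsub>M\<^esub>}"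
    and b: "b \<in> carrier N" "\<And>y. y \<in> carrier N \<Longrightarrow> b \<preceq>\<^bsub>N\<^esub> y"
  shows "min_upper (poset_of S) (Inl ` X) = {Inr b}"
proof -
  have "Upper (poset_of S) (Inl ` X) = Inr ` carrier N"
    using assms(2) by (auto simp: Upper_Inl[OF assms(1)])
  then show ?thesis
    using b N.leq_antisym by (fastforce simp: mem_min_upper_iff)
qed

lemma max_lower_Inl:
  assumes "X \<noteq> {}" "X \<subseteq> carrier M - {\<one>\<^bsub>M\<^esub>}"
  shows "max_lower (poset_of S) (Inl ` X \<union> Inr ` Y) = Inl ` max_lower (poset_of M) X"
  by (auto simp: mem_max_lower_iff Lower_Inl[OF assms])

text \<open>
  All elements of \<open>M\<close> other than the top are lower bounds of \<open>Inr ` Y\<close>. The bottom of \<open>N\<close> is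
  a larger one, which excludes them from the maximal lower bounds.
\<close>

lemma max_lower_Inr:
  assumes "Y \<subseteq> carrier N" "has_bottom N"
  shows "max_lower (poset_of S) (Inr ` Y) = Inr ` max_lower (poset_of N) Y"
proof -
  obtain b where b: "b \<in> carrier N" "\<And>y. y \<in> carrier N \<Longrightarrow> b \<preceq>\<^bsub>N\<^esub> y"
    using assms(2) by (rule has_bottomE) blast
  then have b': "b \<in> Lower (poset_of N) Y"
    by (auto simp: mem_Lower_iff)
  show ?thesis
  proof (rule Set.set_eqI)
    fix z show "z \<in> max_lower (poset_of S) (Inr ` Y) \<longleftrightarrow> z \<in> Inr ` max_lower (poset_of N) Y"
      using b' by (cases z) (auto simp: mem_max_lower_iff Lower_Inr[OF assms(1)] ball_Un)
  qed
qed

lemma subset_S_split: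
  assumes "finite Z" "Z \<subseteq> carrier S"
  obtains X Y where "finite X" "X \<subseteq> carrier M - {\<one>\<^bsub>M\<^esub>}" "finite Y" "Y \<subseteq> carrier N"
    "Z = Inl ` X \<union> Inr ` Y"
proof
  show "finite (Inl -` Z)" "finite (Inr -` Z)"
    using assms(1) by (auto intro: finite_vimageI)
  show "Inl -` Z \<subseteq> carrier M - {\<one>\<^bsub>M\<^esub>}" "Inr -` Z \<subseteq> carrier N"
    using assms(2) S_simps(1,2) by blast+
  show "Z = Inl ` (Inl -` Z) \<union> Inr ` (Inr -` Z)"
    by (auto simp: image_iff) (metis old.sum.exhaust)
qed

end


section \<open>The ordinal sum of residuated multilattices\<close>

locale bounded_rml_summands = M: residuated_multilattice M + N: residuated_multilattice N
  for M :: "('a, 'm) pocrim_scheme" and N :: "('b, 'n) pocrim_scheme" +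
  assumes bottom_M: "has_bottom M" and bottom_N: "has_bottom N"
begin

sublocale ordinal_summands M N ..

lemma S_min_upper_below:
  assumes "finite Z" "Z \<subseteq> carrier S" "u \<in> Upper (poset_of S) Z"
  shows "\<exists>m \<in> min_upper (poset_of S) Z. m \<preceq>\<^bsub>S\<^esub> u"
proof -
  obtain X Y where X: "finite X" "X \<subseteq> carrier M - {\<one>\<^bsub>M\<^esub>}" and Y: "finite Y" "Y \<subseteq> carrier N"
    and Z: "Z = Inl ` X \<union> Inr ` Y"
    using assms(1,2) by (rule subset_S_split)
  have X': "X \<subseteq> carrier M"
    using X by auto
  show ?thesis
  proof (cases "Y = {}")
    case False
    then obtain v where v: "u = Inr v" "v \<in> Upper (poset_of N) Y"
      using assms(3) Y Z by (auto simp: Upper_Inr)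
    then obtain m where "m \<in> min_upper (poset_of N) Y" "m \<preceq>\<^bsub>N\<^esub> v"
      using N.min_upper_below[of Y v] Y by auto
    then show ?thesis
      using False Y Z v by (auto simp: min_upper_Inr)
  next
    case True
    then have Z: "Z = Inl ` X"
      using Z by simp
    show ?thesis
    proof (cases "Upper (poset_of M) X \<subseteq> {\<one>\<^bsub>M\<^esub>}")
      case True
      obtain b where b: "b \<in> carrier N" "\<And>y. y \<in> carrier N \<Longrightarrow> b \<preceq>\<^bsub>N\<^esub> y"
        using bottom_N by (rule has_bottomE) blast
      have "Inr b \<preceq>\<^bsub>S\<^esub> u"
        using assms(3) True X b by (auto simp: Z Upper_Inl)
      then show ?thesis
        using min_upper_Inl_top[OF X(2) True b] Z by simp
    next
      case False
      then obtain v where v: "v \<in> Upper (poset_of M) X" "v \<noteq> \<one>\<^bsub>M\<^esub>" "Inl v \<preceq>\<^bsub>S\<^esub> u"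
        using assms(3) X(2) M.leq_refl by (auto simp: Z Upper_Inl) (auto simp: mem_Upper_iff)
      then obtain m where m: "m \<in> min_upper (poset_of M) X" "m \<preceq>\<^bsub>M\<^esub> v"
        using M.min_upper_below[of X v] X X' by auto
      then have "Inl m \<in> min_upper (poset_of S) Z"
        using min_upper_Inl[OF X(2) v(1,2)] Z by simp
      moreover have "Inl m \<preceq>\<^bsub>S\<^esub> u"
        using m v assms(3) calculation
        by (cases u) (auto simp: mem_min_upper_iff mem_Upper_iff intro: M.leq_trans)
      ultimately show ?thesis
        by blast
    qed
  qed
qed

lemma S_max_lower_above:
  assumes "finite Z" "Z \<subseteq> carrier S" "l \<in> Lower (poset_of S) Z"
  shows "\<exists>m \<in> max_lower (poset_of S) Z. l \<preceq>\<^bsub>S\<^esub> m"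
proof -
  obtain X Y where X: "finite X" "X \<subseteq> carrier M - {\<one>\<^bsub>M\<^esub>}" and Y: "finite Y" "Y \<subseteq> carrier N"
    and Z: "Z = Inl ` X \<union> Inr ` Y"
    using assms(1,2) by (rule subset_S_split)
  show ?thesis
  proof (cases "X = {}")
    case False
    then obtain k where k: "l = Inl k" "k \<in> Lower (poset_of M) X"
      using assms(3) X Z by (auto simp: Lower_Inl)
    moreover have "X \<subseteq> carrier M"
      using X by auto
    ultimately obtain m where "m \<in> max_lower (poset_of M) X" "k \<preceq>\<^bsub>M\<^esub> m"
      using M.max_lower_above[of X k] X by auto
    then show ?thesis
      using False X Z k by (auto simp: max_lower_Inl)
  next
    case True
    then have Z: "Z = Inr ` Y"
      using Z by simp
    obtain b where b: "b \<in> carrier N" "\<And>y. y \<in> carrier N \<Longrightarrow> b \<preceq>\<^bsub>N\<^esub> y"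
      using bottom_N by (rule has_bottomE) blast
    have "\<exists>k \<in> Lower (poset_of N) Y. l \<preceq>\<^bsub>S\<^esub> Inr k"
    proof (cases l)
      case (Inl x)
      then show ?thesis
        using b Y by (auto simp: mem_Lower_iff)
    next
      case (Inr y)
      then have "y \<in> Lower (poset_of N) Y"
        using assms(3) Y by (auto simp: Z Lower_Inr)
      moreover from this have "l \<preceq>\<^bsub>S\<^esub> Inr y"
        using Inr by (simp add: mem_Lower_iff N.leq_refl)
      ultimately show ?thesis
        by blast
    qed
    then obtain k where k: "k \<in> Lower (poset_of N) Y" "l \<preceq>\<^bsub>S\<^esub> Inr k"
      by blast
    then obtain m where m: "m \<in> max_lower (poset_of N) Y" "k \<preceq>\<^bsub>N\<^esub> m"
      using N.max_lower_above[of Y k] Y by auto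
    then have "Inr m \<in> max_lower (poset_of S) Z"
      using max_lower_Inr[OF Y(2) bottom_N] Z by simp
    moreover have "l \<preceq>\<^bsub>S\<^esub> Inr m"
      using k m assms(3) calculation
      by (cases l) (auto simp: mem_max_lower_iff mem_Lower_iff intro: N.leq_trans)
    ultimately show ?thesis
      by blast
  qed
qed

theorem S_residuated_multilattice: "residuated_multilattice S"
  by unfold_locales (simp_all add: S_min_upper_below S_max_lower_above del: S_simps)

lemma mjoin_Inl:
  assumes "x \<in> carrier M - {\<one>\<^bsub>M\<^esub>}" "y \<in> carrier M - {\<one>\<^bsub>M\<^esub>}"
    and "u \<in> Upper (poset_of M) {x, y}" "u \<noteq> \<one>\<^bsub>M\<^esub>"
  shows "mjoin S (Inl x) (Inl y) = Inl ` mjoin M x y"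
  using min_upper_Inl[of "{x, y}" u] assms by (simp add: mjoin_def)

lemma mmeet_Inl:
  assumes "x \<in> carrier M - {\<one>\<^bsub>M\<^esub>}" "y \<in> carrier M - {\<one>\<^bsub>M\<^esub>}"
  shows "mmeet S (Inl x) (Inl y) = Inl ` mmeet M x y"
  using max_lower_Inl[of "{x, y}" "{}"] assms by (simp add: mmeet_def)

lemma mjoin_Inr:
  assumes "x \<in> carrier N" "y \<in> carrier N"
  shows "mjoin S (Inr x) (Inr y) = Inr ` mjoin N x y"
  using min_upper_Inr[of "{x, y}" "{}"] assms by (simp add: mjoin_def)

lemma mmeet_Inr:
  assumes "x \<in> carrier N" "y \<in> carrier N"
  shows "mmeet S (Inr x) (Inr y) = Inr ` mmeet N x y"
  using max_lower_Inr[of "{x, y}"] assms bottom_N by (simp add: mmeet_def)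

lemma mjoin_Inl_Inr:
  assumes "Inl x \<in> carrier S" "Inr y \<in> carrier S"
  shows "mjoin S (Inl x) (Inr y) = {Inr y}" "mjoin S (Inr y) (Inl x) = {Inr y}"
  using S.mjoin_of_leq[OF _ assms] by (simp_all add: S.mjoin_commute)

lemma mmeet_Inl_Inr:
  assumes "Inl x \<in> carrier S" "Inr y \<in> carrier S"
  shows "mmeet S (Inl x) (Inr y) = {Inl x}" "mmeet S (Inr y) (Inl x) = {Inl x}"
  using S.mmeet_of_leq[OF _ assms] by (simp_all add: S.mmeet_commute)


section \<open>The first summand as a full submultilattice\<close>

lemma osum_inl_image_iff:
  "Inl x \<in> osum_inl M N ` carrier M \<longleftrightarrow> x \<in> carrier M \<and> x \<noteq> \<one>\<^bsub>M\<^esub>"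
  "Inr y \<in> osum_inl M N ` carrier M \<longleftrightarrow> y = \<one>\<^bsub>N\<^esub>"
  by (auto simp: osum_inl_def image_iff)

text \<open>
  The element \<open>c\<close> is an upper bound other than the top of any two elements of \<open>M\<close> other than the
  top, so their minimal upper bounds are formed in \<open>M\<close>.
\<close>

lemma full_submultilattice_of_greatest_coatom:
  assumes c: "c \<in> carrier M" "c \<noteq> \<one>\<^bsub>M\<^esub>"
    and above: "\<And>x. \<lbrakk>x \<in> carrier M; x \<noteq> \<one>\<^bsub>M\<^esub>\<rbrakk> \<Longrightarrow> x \<preceq>\<^bsub>M\<^esub> c"
  shows "full_submultilattice S (osum_inl M N ` carrier M)"
proof -
  let ?M = "osum_inl M N ` carrier M"
  have "x \<otimes>\<^bsub>S\<^esub> y \<in> ?M \<and> x \<leadsto>\<^bsub>S\<^esub> y \<in> ?M \<and> mjoin S x y \<subseteq> ?M \<and> mmeet S x y \<subseteq> ?M"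
    if "x \<in> ?M" "y \<in> ?M" for x y
  proof (cases x; cases y)
    fix a b assume xy: "x = Inl a" "y = Inl b"
    then have ab: "a \<in> carrier M - {\<one>\<^bsub>M\<^esub>}" "b \<in> carrier M - {\<one>\<^bsub>M\<^esub>}"
      using that by (auto simp: osum_inl_image_iff)
    have join: "mjoin S x y = Inl ` mjoin M a b"
      unfolding xy using ab c above by (intro mjoin_Inl[of _ _ c]) (auto simp: mem_Upper_iff)
    have "mjoin S x y \<subseteq> ?M" "mmeet S x y \<subseteq> ?M"
      using mjoin_subset_carrier[of S x y] mmeet_subset_carrier[of S x y] ab
      unfolding join unfolding xy mmeet_Inl[OF ab] by (auto simp: osum_inl_image_iff)
    then show ?thesis
      using ab by (simp add: xy M.imp_closed)
  next
    fix a b assume xy: "x = Inl a" "y = Inr b"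
    then have "a \<in> carrier M" "a \<noteq> \<one>\<^bsub>M\<^esub>" "b = \<one>\<^bsub>N\<^esub>"
      using that by (auto simp: osum_inl_image_iff)
    then show ?thesis
      by (simp add: xy mjoin_Inl_Inr mmeet_Inl_Inr osum_inl_image_iff)
  next
    fix a b assume xy: "x = Inr a" "y = Inl b"
    then have "b \<in> carrier M" "b \<noteq> \<one>\<^bsub>M\<^esub>" "a = \<one>\<^bsub>N\<^esub>"
      using that by (auto simp: osum_inl_image_iff)
    then show ?thesis
      by (simp add: xy mjoin_Inl_Inr mmeet_Inl_Inr osum_inl_image_iff)
  next
    fix a b assume xy: "x = Inr a" "y = Inr b"
    then have "a = \<one>\<^bsub>N\<^esub>" "b = \<one>\<^bsub>N\<^esub>"
      using that by (auto simp: osum_inl_image_iff)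
    then show ?thesis
      by (simp add: xy S.mjoin_of_leq S.mmeet_of_leq osum_inl_image_iff N.imp_one N.leq_refl)
  qed
  moreover have "?M \<subseteq> carrier S"
    using osum_inl_closed by blast
  ultimately show ?thesis
    by (simp add: full_submultilattice_def osum_inl_image_iff)
qed

text \<open>
  The join of two different coatoms in \<open>S\<close> is the bottom of \<open>N\<close>. The only element of \<open>N\<close> that
  belongs to \<open>M\<close> is the top, and bottom and top of \<open>N\<close> differ when \<open>N\<close> is nontrivial.
\<close>

lemma coatoms_eq_of_full_submultilattice:
  assumes full: "full_submultilattice S (osum_inl M N ` carrier M)"
    and N: "carrier N \<noteq> {\<one>\<^bsub>N\<^esub>}"
    and c: "coatom M c" and d: "coatom M d"
  shows "c = d"
proof (rule ccontr)
  assume "c \<noteq> d"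
  have cd: "{c, d} \<subseteq> carrier M - {\<one>\<^bsub>M\<^esub>}"
    using c d by (auto simp: coatom_def)
  have upper: "Upper (poset_of M) {c, d} \<subseteq> {\<one>\<^bsub>M\<^esub>}"
  proof
    fix u assume u: "u \<in> Upper (poset_of M) {c, d}"
    show "u \<in> {\<one>\<^bsub>M\<^esub>}"
      using c d u \<open>c \<noteq> d\<close> unfolding coatom_def mem_Upper_iff by blast
  qed
  obtain b where b: "b \<in> carrier N" "\<And>y. y \<in> carrier N \<Longrightarrow> b \<preceq>\<^bsub>N\<^esub> y"
    using bottom_N by (rule has_bottomE) blast
  have "mjoin S (Inl c) (Inl d) = {Inr b}"
    using min_upper_Inl_top[OF cd upper b] by (simp add: mjoin_def)
  moreover have "Inl c \<in> osum_inl M N ` carrier M" "Inl d \<in> osum_inl M N ` carrier M"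
    using cd by (simp_all add: osum_inl_image_iff)
  then have "mjoin S (Inl c) (Inl d) \<subseteq> osum_inl M N ` carrier M"
    using full unfolding full_submultilattice_def by blast
  ultimately have "b = \<one>\<^bsub>N\<^esub>"
    by (simp add: osum_inl_image_iff)
  then show False
    using N b N.one_leq_iff by blast
qed

theorem full_submultilattice_M_iff:
  assumes M: "carrier M \<noteq> {\<one>\<^bsub>M\<^esub>}" and N: "carrier N \<noteq> {\<one>\<^bsub>N\<^esub>}" and "coatomic M"
  shows "full_submultilattice S (osum_inl M N ` carrier M) \<longleftrightarrow> (\<exists>!c. coatom M c)"
proof
  assume full: "full_submultilattice S (osum_inl M N ` carrier M)"
  have "\<exists>c. coatom M c"
    using M \<open>coatomic M\<close> M.one_closed by (auto simp: coatomic_def)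
  then show "\<exists>!c. coatom M c"
    using coatoms_eq_of_full_submultilattice[OF full N] by blast
next
  assume "\<exists>!c. coatom M c"
  then obtain c where c: "coatom M c" and unique: "\<And>d. coatom M d \<Longrightarrow> d = c"
    by (elim ex1E) blast
  show "full_submultilattice S (osum_inl M N ` carrier M)"
  proof (rule full_submultilattice_of_greatest_coatom)
    show "c \<in> carrier M" "c \<noteq> \<one>\<^bsub>M\<^esub>"
      using c by (simp_all add: coatom_def)
    fix x assume "x \<in> carrier M" "x \<noteq> \<one>\<^bsub>M\<^esub>"
    then obtain d where "coatom M d" "x \<preceq>\<^bsub>M\<^esub> d"
      using \<open>coatomic M\<close> unfolding coatomic_def by blast
    then show "x \<preceq>\<^bsub>M\<^esub> c"
      using unique by simp
  qed
qed


section \<open>The second summand as a filter\<close>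

lemma deductive_system_N: "deductive_system S (Inr ` carrier N)"
  unfolding deductive_system_def
proof (intro conjI ballI impI)
  fix x y assume "x \<in> Inr ` carrier N" "y \<in> carrier S" "x \<leadsto>\<^bsub>S\<^esub> y \<in> Inr ` carrier N"
  then show "y \<in> Inr ` carrier N"
    by (cases y) auto
qed auto

lemma mjoin_mmeet_N:
  assumes "x \<in> carrier N" "y \<in> carrier N"
  shows "mjoin S (Inr x) (Inr y) \<subseteq> Inr ` carrier N" "mmeet S (Inr x) (Inr y) \<subseteq> Inr ` carrier N"
  using assms mjoin_subset_carrier[of N x y] mmeet_subset_carrier[of N x y]
  by (auto simp: mjoin_Inr mmeet_Inr)

theorem full_submultilattice_N: "full_submultilattice S (Inr ` carrier N)"
  using mjoin_mmeet_N by (auto simp: full_submultilattice_def N.imp_closed)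

text \<open>
  If \<open>x \<leadsto> y \<in> N\<close>, then \<open>x \<le> y\<close>, and join and meet are \<open>y\<close> and \<open>x\<close>, or both elements lie in
  \<open>N\<close>, which is closed under all operations.
\<close>

theorem rml_filter_N: "rml_filter S (Inr ` carrier N)"
  unfolding rml_filter_def
proof (intro conjI deductive_system_N ballI impI)
  fix x y assume xy: "x \<in> carrier S" "y \<in> carrier S" "x \<leadsto>\<^bsub>S\<^esub> y \<in> Inr ` carrier N"
  consider "x \<preceq>\<^bsub>S\<^esub> y" | a b where "x = Inr a" "y = Inr b" "a \<in> carrier N" "b \<in> carrier N"
    using xy imp_in_N_iff[OF xy(1,2)] by (cases x; cases y) (auto simp: M.one_leq_iff)
  then have "(\<lambda>t. t \<leadsto>\<^bsub>S\<^esub> y) ` mjoin S x y \<subseteq> Inr ` carrier N \<and>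
    (\<lambda>t. x \<leadsto>\<^bsub>S\<^esub> t) ` mmeet S x y \<subseteq> Inr ` carrier N"
  proof cases
    case 1
    then show ?thesis
      using xy(1,2)
      by (simp add: S.mjoin_of_leq S.mmeet_of_leq imp_in_N_iff M.leq_refl proj.p_closed del: S_simps)
  next
    case 2
    have "t \<leadsto>\<^bsub>S\<^esub> s \<in> Inr ` carrier N"
      if "t \<in> Inr ` carrier N" "s \<in> Inr ` carrier N" for t s
      using that by (auto simp: N.imp_closed)
    moreover have "x \<in> Inr ` carrier N" "y \<in> Inr ` carrier N"
      "mjoin S x y \<subseteq> Inr ` carrier N" "mmeet S x y \<subseteq> Inr ` carrier N"
      unfolding 2(1,2) using 2(3,4) mjoin_mmeet_N[of a b] by simp_all
    ultimately show ?thesis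
      unfolding image_subset_iff by blast
  qed
  then show "(\<lambda>t. t \<leadsto>\<^bsub>S\<^esub> y) ` mjoin S x y \<subseteq> Inr ` carrier N"
    and "(\<lambda>t. x \<leadsto>\<^bsub>S\<^esub> t) ` mmeet S x y \<subseteq> Inr ` carrier N"
    by blast+
qed


section \<open>Consistency of the second summand\<close>

text \<open>
  Consistency depends on the element \<open>z\<close> in its definition only through \<open>proj z\<close>, so that \<open>z\<close>
  may range over \<open>M\<close>.
\<close>

lemma consistent_N_iff:
  "consistent S (Inr ` carrier N) \<longleftrightarrow>
     (\<forall>x \<in> carrier S. \<forall>y \<in> carrier S. \<forall>z \<in> carrier M.
        (proj x \<preceq>\<^bsub>M\<^esub> z \<and> proj y \<preceq>\<^bsub>M\<^esub> z \<longrightarrow> (\<forall>t \<in> mjoin S x y. proj t \<preceq>\<^bsub>M\<^esub> z)) \<and>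
        (z \<preceq>\<^bsub>M\<^esub> proj x \<and> z \<preceq>\<^bsub>M\<^esub> proj y \<longrightarrow> (\<forall>t \<in> mmeet S x y. z \<preceq>\<^bsub>M\<^esub> proj t)))"
proof -
  have join: "(\<lambda>t. t \<leadsto>\<^bsub>S\<^esub> z) ` mjoin S x y \<subseteq> Inr ` carrier N \<longleftrightarrow>
      (\<forall>t \<in> mjoin S x y. proj t \<preceq>\<^bsub>M\<^esub> proj z)"
    and meet: "(\<lambda>t. z \<leadsto>\<^bsub>S\<^esub> t) ` mmeet S x y \<subseteq> Inr ` carrier N \<longleftrightarrow>
      (\<forall>t \<in> mmeet S x y. proj z \<preceq>\<^bsub>M\<^esub> proj t)"
    if "z \<in> carrier S" for x y z
    unfolding image_subset_iff
    using that imp_in_N_iff mjoin_subset_carrier[of S x y] mmeet_subset_carrier[of S x y]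
    by blast+
  show ?thesis
    unfolding consistent_def proj.p_onto[symmetric] ball_simps
    using deductive_system_N imp_in_N_iff join meet
    by (simp del: S_simps cong: ball_cong)
qed

text \<open>
  If \<open>x\<close> or \<open>y\<close> lies in \<open>N\<close>, then the top is the only upper bound \<open>z\<close> of their images, and the
  meet is the one of them that lies in \<open>M\<close> or is contained in \<open>N\<close>. For two elements of \<open>M\<close> with an upper bound other than the top,
  the minimal upper bounds in \<open>S\<close> and in \<open>M\<close> agree, and in a lattice there is only one.
\<close>

lemma consistent_N_of_lattice:
  assumes "residuated_lattice M"
  shows "consistent S (Inr ` carrier N)"
proof -
  interpret L: residuated_lattice M by fact
  have join: "proj t \<preceq>\<^bsub>M\<^esub> z"
    if xy: "x \<in> carrier S" "y \<in> carrier S" and z: "z \<in> carrier M"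
      and le: "proj x \<preceq>\<^bsub>M\<^esub> z" "proj y \<preceq>\<^bsub>M\<^esub> z" and t: "t \<in> mjoin S x y" for x y z t
  proof (cases "z = \<one>\<^bsub>M\<^esub>")
    case True
    then show ?thesis
      using t mjoin_subset_carrier[of S x y] proj.p_closed M.top_greatest by blast
  next
    case False
    then obtain a b where ab: "x = Inl a" "y = Inl b"
      "a \<in> carrier M - {\<one>\<^bsub>M\<^esub>}" "b \<in> carrier M - {\<one>\<^bsub>M\<^esub>}"
      using xy z le by (cases x; cases y) (auto simp: M.one_leq_iff)
    obtain s where s: "least (poset_of M) s (Upper (poset_of M) {a, b})"
      using L.sup_of_two_exists[of a b] ab by auto
    have z': "z \<in> Upper (poset_of M) {a, b}"
      using z le ab by (auto simp: mem_Upper_iff)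
    have "t = Inl s"
      using t mjoin_Inl[OF ab(3,4) z' False] M.min_upper_of_least[OF s] ab by (simp add: mjoin_def)
    then show ?thesis
      using s z' by (simp add: least_def)
  qed
  have meet: "z \<preceq>\<^bsub>M\<^esub> proj t"
    if xy: "x \<in> carrier S" "y \<in> carrier S" and z: "z \<in> carrier M"
      and le: "z \<preceq>\<^bsub>M\<^esub> proj x" "z \<preceq>\<^bsub>M\<^esub> proj y" and t: "t \<in> mmeet S x y" for x y z t
  proof (cases x; cases y)
    fix a b assume ab: "x = Inl a" "y = Inl b"
    obtain i where i: "greatest (poset_of M) i (Lower (poset_of M) {a, b})"
      using L.inf_of_two_exists[of a b] ab xy by auto
    have "t = Inl i"
      using t ab xy mmeet_Inl[of a b] M.max_lower_of_greatest[OF i] by (simp add: mmeet_def)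
    moreover have "z \<in> Lower (poset_of M) {a, b}"
      using z le ab by (auto simp: mem_Lower_iff)
    ultimately show ?thesis
      using i by (simp add: greatest_def)
  next
    fix a b assume "x = Inl a" "y = Inr b"
    then show ?thesis
      using t xy le by (simp add: mmeet_Inl_Inr)
  next
    fix a b assume "x = Inr a" "y = Inl b"
    then show ?thesis
      using t xy le by (simp add: mmeet_Inl_Inr)
  next
    fix a b assume "x = Inr a" "y = Inr b"
    then show ?thesis
      using t xy z by (auto simp: mmeet_Inr M.top_greatest)
  qed
  show ?thesis
    unfolding consistent_N_iff using join meet by blast
qed

text \<open>
  Two elements of \<open>M\<close> without an upper bound other than the top have the top as least upper bound.
  Joins in \<open>S\<close> and \<open>M\<close> may differ in this case, so it is treated before consistency is used.
  Pairs containing the top of \<open>M\<close>, which is not of the form \<open>Inl x\<close> in \<open>S\<close>, are trivial.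
\<close>

lemma lattice_of_consistent_N:
  assumes "consistent S (Inr ` carrier N)"
  shows "residuated_lattice M"
proof -
  have join: "proj t \<preceq>\<^bsub>M\<^esub> z"
    if "x \<in> carrier S" "y \<in> carrier S" "z \<in> carrier M" "proj x \<preceq>\<^bsub>M\<^esub> z" "proj y \<preceq>\<^bsub>M\<^esub> z"
      "t \<in> mjoin S x y" for x y z t
    using assms that unfolding consistent_N_iff by blast
  have meet: "z \<preceq>\<^bsub>M\<^esub> proj t"
    if "x \<in> carrier S" "y \<in> carrier S" "z \<in> carrier M" "z \<preceq>\<^bsub>M\<^esub> proj x" "z \<preceq>\<^bsub>M\<^esub> proj y"
      "t \<in> mmeet S x y" for x y z t
    using assms that unfolding consistent_N_iff by blast
  show ?thesis
  proof unfold_locales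
    fix x y assume "x \<in> carrier (poset_of M)" "y \<in> carrier (poset_of M)"
    then have xy: "x \<in> carrier M" "y \<in> carrier M"
      by simp_all
    show "\<exists>s. least (poset_of M) s (Upper (poset_of M) {x, y})"
    proof (cases "Upper (poset_of M) {x, y} \<subseteq> {\<one>\<^bsub>M\<^esub>}")
      case True
      then have "Upper (poset_of M) {x, y} = {\<one>\<^bsub>M\<^esub>}"
        using xy M.top_greatest by (auto simp: mem_Upper_iff)
      then show ?thesis
        by (auto simp: least_def M.leq_refl)
    next
      case False
      then obtain u where u: "u \<in> Upper (poset_of M) {x, y}" "u \<noteq> \<one>\<^bsub>M\<^esub>"
        by blast
      then have xy': "x \<in> carrier M - {\<one>\<^bsub>M\<^esub>}" "y \<in> carrier M - {\<one>\<^bsub>M\<^esub>}"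
        using xy M.one_leq_iff by (auto simp: mem_Upper_iff)
      obtain s where s: "s \<in> mjoin M x y"
        using M.min_upper_below[of "{x, y}" u] u xy by (auto simp: mjoin_def)
      have "s \<preceq>\<^bsub>M\<^esub> z" if "z \<in> Upper (poset_of M) {x, y}" for z
        using join[of "Inl x" "Inl y" z "Inl s"] that s xy' mjoin_Inl[OF xy' u]
        by (auto simp: mem_Upper_iff)
      then have "least (poset_of M) s (Upper (poset_of M) {x, y})"
        using s by (auto simp: least_def mjoin_def mem_min_upper_iff mem_Upper_iff)
      then show ?thesis ..
    qed
    show "\<exists>i. greatest (poset_of M) i (Lower (poset_of M) {x, y})"
    proof (cases "x = \<one>\<^bsub>M\<^esub> \<or> y = \<one>\<^bsub>M\<^esub>")
      case True
      then have "greatest (poset_of M) x (Lower (poset_of M) {x, y}) \<or>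
          greatest (poset_of M) y (Lower (poset_of M) {x, y})"
        using xy M.top_greatest M.leq_refl by (auto simp: greatest_def mem_Lower_iff)
      then show ?thesis
        by blast
    next
      case False
      then have xy': "x \<in> carrier M - {\<one>\<^bsub>M\<^esub>}" "y \<in> carrier M - {\<one>\<^bsub>M\<^esub>}"
        using xy by auto
      obtain b where "b \<in> Lower (poset_of M) {x, y}"
        using bottom_M xy by (metis has_bottomE Int_iff mem_Lower_iff)
      then obtain i where i: "i \<in> mmeet M x y"
        using M.max_lower_above[of "{x, y}" b] xy by (auto simp: mmeet_def)
      have "z \<preceq>\<^bsub>M\<^esub> i" if "z \<in> Lower (poset_of M) {x, y}" for z
        using meet[of "Inl x" "Inl y" z "Inl i"] that i xy' mmeet_Inl[OF xy']
        by (auto simp: mem_Lower_iff)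
      then have "greatest (poset_of M) i (Lower (poset_of M) {x, y})"
        using i by (auto simp: greatest_def mmeet_def mem_max_lower_iff mem_Lower_iff)
      then show ?thesis ..
    qed
  qed
qed

end

section \<open>The ordinal sum of bounded residuated multilattices\<close>

theorem proposition3p8:
  fixes M :: "'a pocrim" and N :: "'b pocrim"
  assumes "residuated_multilattice M" and "has_bottom M"
    and "residuated_multilattice N" and "has_bottom N"
  shows
    "residuated_multilattice (ordinal_sum M N) \<and>
     (carrier M \<noteq> {\<one>\<^bsub>M\<^esub>} \<and> carrier N \<noteq> {\<one>\<^bsub>N\<^esub>} \<and> coatomic M \<longrightarrow>
       (full_submultilattice (ordinal_sum M N) (osum_inl M N ` carrier M)
          \<longleftrightarrow> (\<exists>!c. coatom M c))) \<and>
     (rml_filter (ordinal_sum M N) (Inr ` carrier N) \<and>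
      full_submultilattice (ordinal_sum M N) (Inr ` carrier N)) \<and>
     (residuated_multilattice (quotient_pocrim (ordinal_sum M N) (Inr ` carrier N)) \<and>
      (\<exists>h \<in> rml_iso (quotient_pocrim (ordinal_sum M N) (Inr ` carrier N)) M.
         (\<forall>x \<in> carrier M - {\<one>\<^bsub>M\<^esub>}.
            h (filter_rel (ordinal_sum M N) (Inr ` carrier N) `` {osum_inl M N x}) = x) \<and>
         (\<forall>y \<in> carrier N.
            h (filter_rel (ordinal_sum M N) (Inr ` carrier N) `` {Inr y}) = \<one>\<^bsub>M\<^esub>))) \<and>
     (rml_filter (ordinal_sum M N) (Inr ` carrier N) \<and>
      consistent (ordinal_sum M N) (Inr ` carrier N)
        \<longleftrightarrow> residuated_lattice M)"
proof -
  interpret bounded_rml_summands M N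
    using assms by (simp add: bounded_rml_summands_def bounded_rml_summands_axioms_def)
  have "residuated_multilattice (quotient_pocrim S (Inr ` carrier N))"
    using proj.quotient_residuated_multilattice[OF assms(1)] by (simp only: kernel_proj)
  moreover obtain h where h: "h \<in> rml_iso (quotient_pocrim S (Inr ` carrier N)) M"
    and h_class: "\<And>x. x \<in> carrier S \<Longrightarrow> h (filter_rel S (Inr ` carrier N) `` {x}) = proj x"
    using proj.quotient_isomorphism unfolding kernel_proj by blast
  moreover have "h (filter_rel S (Inr ` carrier N) `` {osum_inl M N x}) = x"
    if "x \<in> carrier M - {\<one>\<^bsub>M\<^esub>}" for x
    using that h_class[OF osum_inl_closed, of x] by (simp add: osum_inl_def)
  moreover have "h (filter_rel S (Inr ` carrier N) `` {Inr y}) = \<one>\<^bsub>M\<^esub>" if "y \<in> carrier N" for y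
    using that h_class[of "Inr y"] by simp
  ultimately show ?thesis
    using S_residuated_multilattice full_submultilattice_M_iff rml_filter_N full_submultilattice_N
      consistent_N_of_lattice lattice_of_consistent_N by blast
qed

end
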